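(* For every topological group $G$, the action of $G$ on the universal minimal compact $G$-space $M_G$ is not 3-transitive.
   Context: Compact spaces are assumed to be Hausdorff, and all maps are assumed to be continuous. For a topological group $G$, a $G$-space is a topological space $X$ with a continuous action of $G$, that is, a continuous map $G\times X\to X$, $(g,x)\mapsto gx$, satisfying $g(hx)=(gh)x$ and $1x=x$ for all $g,h\in G$, $x\in X$. A $G$-space $X$ is minimal if it has no proper (non-empty) $G$-invariant closed subsets or, equivalently, if the orbit $Gx$ is dense in $X$ for every $x\in X$. A $G$-map $f:X\to Y$ between $G$-spaces is a continuous map with $f(gx)=gf(x)$ for all $g\in G$, $x\in X$. The universal minimal compact $G$-space $M_G$ is characterized by the following property: $M_G$ is a (non-empty) minimal compact $G$-space, and for every (non-empty) compact minimal $G$-space $X$ there exists a $G$-map of $M_G$ onto $X$. Consequently, for every non-empty compact $G$-space $X$, minimal or not, there exists a $G$-map $M_G\to X$. It is known that $M_G$ exists and is unique up to isomorphism of $G$-spaces. The action of a group $G$ on a $G$-space $X$ is 3-transitive if $|X|\ge 3$ and for any triples $(a_1,a_2,a_3)$ and $(b_1,b_2,b_3)$ of distinct points in $X$ (the points within each triple being pairwise distinct) there exists $g\in G$ such that $ga_i=b_i$ for $i=1,2,3$. *)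

theory Defs
  imports "HOL-Analysis.Analysis"
begin

text \<open>
  A topological group is a type of class \<^class>\<open>topological_group_add\<close>: the operation
  is written additively but is not assumed commutative, and the topology is not assumed Hausdorff.
  The underlying space of a \<open>G\<close>-space is a topology \<open>X\<close> with carrier \<open>topspace X\<close>;
  the values of the action outside \<open>topspace X\<close> are irrelevant.
\<close>

definition G_space :: "('g::topological_group_add \<Rightarrow> 'x \<Rightarrow> 'x) \<Rightarrow> 'x topology \<Rightarrow> bool" where
  "G_space act X \<longleftrightarrow>
     continuous_map (prod_topology euclidean X) X (\<lambda>(g, x). act g x) \<and>
     (\<forall>g h. \<forall>x\<in>topspace X. act g (act h x) = act (g + h) x) \<and>
     (\<forall>x\<in>topspace X. act 0 x = x)"

definition G_invariant :: "('g \<Rightarrow> 'x \<Rightarrow> 'x) \<Rightarrow> 'x set \<Rightarrow> bool" where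
  "G_invariant act S \<longleftrightarrow> (\<forall>g. \<forall>x\<in>S. act g x \<in> S)"

definition G_minimal :: "('g \<Rightarrow> 'x \<Rightarrow> 'x) \<Rightarrow> 'x topology \<Rightarrow> bool" where
  "G_minimal act X \<longleftrightarrow>
     (\<forall>C. closedin X C \<and> G_invariant act C \<and> C \<noteq> {} \<longrightarrow> C = topspace X)"

definition minimal_compact_G_space ::
    "('g::topological_group_add \<Rightarrow> 'x \<Rightarrow> 'x) \<Rightarrow> 'x topology \<Rightarrow> bool" where
  "minimal_compact_G_space act X \<longleftrightarrow>
     G_space act X \<and> topspace X \<noteq> {} \<and> compact_space X \<and> Hausdorff_space X \<and> G_minimal act X"

definition G_map ::
    "('g \<Rightarrow> 'x \<Rightarrow> 'x) \<Rightarrow> 'x topology \<Rightarrow> ('g \<Rightarrow> 'y \<Rightarrow> 'y) \<Rightarrow> 'y topology \<Rightarrow> ('x \<Rightarrow> 'y) \<Rightarrow> bool" where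
  "G_map act X act' Y f \<longleftrightarrow>
     continuous_map X Y f \<and> (\<forall>g. \<forall>x\<in>topspace X. f (act g x) = act' g (f x))"

text \<open>
  The universal property ranges over all minimal compact \<open>G\<close>-spaces. A definition cannot
  quantify over types, so the test spaces are those with carrier in the type \<open>'g set set\<close>.
  This loses nothing: a point \<open>x\<close> of a minimal compact \<open>G\<close>-space is determined by
  the sets \<open>A\<close> of group elements for which \<open>x\<close> lies in the closure of
  \<open>A x0\<close>, so every such space, over any type, has an isomorphic copy in
  \<open>'g set set\<close>. The lemma \<open>universal_minimal_compact_G_space_onto\<close> below
  derives the universal property for carriers in an arbitrary type.
\<close>

definition universal_minimal_compact_G_space ::
    "('g::topological_group_add \<Rightarrow> 'm \<Rightarrow> 'm) \<Rightarrow> 'm topology \<Rightarrow> bool" where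
  "universal_minimal_compact_G_space act M \<longleftrightarrow>
     minimal_compact_G_space act M \<and>
     (\<forall>(act' :: 'g \<Rightarrow> 'g set set \<Rightarrow> 'g set set) X.
        minimal_compact_G_space act' X \<longrightarrow>
        (\<exists>f. G_map act M act' X f \<and> f ` topspace M = topspace X))"

definition three_transitive :: "('g \<Rightarrow> 'x \<Rightarrow> 'x) \<Rightarrow> 'x set \<Rightarrow> bool" where
  "three_transitive act S \<longleftrightarrow>
     (\<exists>T\<subseteq>S. card T = 3) \<and>
     (\<forall>a1\<in>S. \<forall>a2\<in>S. \<forall>a3\<in>S. \<forall>b1\<in>S. \<forall>b2\<in>S. \<forall>b3\<in>S.
        distinct [a1, a2, a3] \<and> distinct [b1, b2, b3] \<longrightarrow>
        (\<exists>g. act g a1 = b1 \<and> act g a2 = b2 \<and> act g a3 = b3))"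

lemma G_space_act_in:
  assumes "G_space act X" "x \<in> topspace X"
  shows "act g x \<in> topspace X"
proof -
  have "(g, x) \<in> topspace (prod_topology euclidean X)" using assms by simp
  then have "(\<lambda>(g, x). act g x) (g, x) \<in> topspace X"
    using assms(1) continuous_map_image_subset_topspace unfolding G_space_def by blast
  then show ?thesis by simp
qed

lemma G_space_continuous_act:
  assumes "G_space act X"
  shows "continuous_map X X (act g)"
proof -
  have "continuous_map X (prod_topology euclidean X) (\<lambda>x. (g, x))"
    by (simp add: continuous_map_pairedI)
  then have "continuous_map X X ((\<lambda>(g, x). act g x) \<circ> (\<lambda>x. (g, x)))"
    by (rule continuous_map_compose) (use assms in \<open>simp add: G_space_def\<close>)
  then show ?thesis by (simp add: comp_def)
qed

lemma minimal_orbit_dense: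
  assumes "minimal_compact_G_space act X" and x0: "x0 \<in> topspace X"
  shows "X closure_of (range (\<lambda>g. act g x0)) = topspace X"
proof -
  let ?O = "range (\<lambda>g. act g x0)"
  have G: "G_space act X" and min: "G_minimal act X"
    using assms unfolding minimal_compact_G_space_def by auto
  have sub: "?O \<subseteq> topspace X"
    using G_space_act_in[OF G x0] by auto
  have "G_invariant act (X closure_of ?O)"
    unfolding G_invariant_def
  proof (intro allI ballI)
    fix g x assume x: "x \<in> X closure_of ?O"
    have "act g ` ?O \<subseteq> ?O"
      using G x0 unfolding G_space_def by auto
    moreover have "act g ` (X closure_of ?O) \<subseteq> X closure_of (act g ` ?O)"
      using G_space_continuous_act[OF G] continuous_map_image_closure_subset by blast
    ultimately show "act g x \<in> X closure_of ?O"
      using x closure_of_mono by blast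
  qed
  moreover have "X closure_of ?O \<noteq> {}"
    using closure_of_subset[OF sub] by auto
  ultimately show ?thesis
    using min closedin_closure_of unfolding G_minimal_def by blast
qed

lemma minimal_embedding:
  fixes act :: "'g::topological_group_add \<Rightarrow> 'x \<Rightarrow> 'x"
  assumes mc: "minimal_compact_G_space act X"
  shows "\<exists>i :: 'x \<Rightarrow> 'g set set. inj_on i (topspace X)"
proof -
  obtain x0 where x0: "x0 \<in> topspace X"
    using mc unfolding minimal_compact_G_space_def by blast
  let ?i = "\<lambda>x. {A. x \<in> X closure_of ((\<lambda>g. act g x0) ` A)}"
  have G: "G_space act X" and H: "Hausdorff_space X"
    using mc unfolding minimal_compact_G_space_def by auto
  have "inj_on ?i (topspace X)"
  proof (rule inj_onI, rule ccontr)
    fix x y assume xy: "x \<in> topspace X" "y \<in> topspace X" "?i x = ?i y" "x \<noteq> y"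
    obtain U V where UV: "openin X U" "openin X V" "x \<in> U" "y \<in> V" "disjnt U V"
      using H xy unfolding Hausdorff_space_def by metis
    let ?A = "{g. act g x0 \<in> U}"
    have "x \<in> X closure_of ((\<lambda>g. act g x0) ` ?A)"
      unfolding in_closure_of
    proof (intro conjI allI impI)
      fix T assume "x \<in> T \<and> openin X T"
      then have "openin X (T \<inter> U)" "x \<in> T \<inter> U" using UV by auto
      moreover have "x \<in> X closure_of (range (\<lambda>g. act g x0))"
        using minimal_orbit_dense[OF mc x0] xy by simp
      ultimately obtain z where "z \<in> range (\<lambda>g. act g x0)" "z \<in> T \<inter> U"
        unfolding in_closure_of by blast
      then show "\<exists>z. z \<in> (\<lambda>g. act g x0) ` ?A \<and> z \<in> T" by auto
    qed (use xy in auto)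
    moreover have "y \<notin> X closure_of ((\<lambda>g. act g x0) ` ?A)"
      using UV unfolding in_closure_of disjnt_def by blast
    ultimately show False using xy(3) by blast
  qed
  then show ?thesis by blast
qed

lemma homeomorphic_copy:
  assumes "inj_on i (topspace X)"
  shows "\<exists>Y j. homeomorphic_maps X Y i j"
proof -
  let ?j = "inv_into (topspace X) i" and ?B = "i ` topspace X"
  let ?Y = "pullback_topology ?B ?j X"
  have top: "topspace ?Y = ?B"
    using assms by (auto simp: topspace_pullback_topology)
  have "continuous_map X ?Y i"
  proof (rule continuous_map_pullback')
    show "continuous_map X X (?j \<circ> i)"
      by (rule continuous_map_eq[OF continuous_map_id]) (simp add: assms)
  qed auto
  moreover have "continuous_map ?Y X ?j"
    using continuous_map_pullback[OF continuous_map_id, of ?B ?j X] by simp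
  ultimately have "homeomorphic_maps X ?Y i ?j"
    unfolding homeomorphic_maps_def top using assms by (auto simp: f_inv_into_f)
  then show ?thesis by blast
qed

lemma minimal_compact_G_space_transport:
  assumes mc: "minimal_compact_G_space act X" and hm: "homeomorphic_maps X Y i j"
  shows "minimal_compact_G_space (\<lambda>g y. i (act g (j y))) Y"
proof -
  let ?a = "\<lambda>g y. i (act g (j y))"
  have G: "G_space act X" and ne: "topspace X \<noteq> {}" and c: "compact_space X"
    and H: "Hausdorff_space X" and min: "G_minimal act X"
    using mc unfolding minimal_compact_G_space_def by blast+
  have ci: "continuous_map X Y i" and cj: "continuous_map Y X j"
    and ji: "\<And>x. x \<in> topspace X \<Longrightarrow> j (i x) = x" and ij: "\<And>y. y \<in> topspace Y \<Longrightarrow> i (j y) = y"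
    using hm unfolding homeomorphic_maps_def by auto
  have iX: "\<And>x. x \<in> topspace X \<Longrightarrow> i x \<in> topspace Y"
    and jY: "\<And>y. y \<in> topspace Y \<Longrightarrow> j y \<in> topspace X"
    using ci cj unfolding continuous_map_def by auto
  have hs: "X homeomorphic_space Y"
    using hm unfolding homeomorphic_space_def by blast
  have "continuous_map (prod_topology euclidean Y) (prod_topology euclidean X) (\<lambda>(g, y). (g, j y))"
    unfolding case_prod_unfold
    using continuous_map_compose[OF continuous_map_snd cj]
    by (intro continuous_map_pairedI) (simp_all add: continuous_map_fst comp_def)
  then have "continuous_map (prod_topology euclidean Y) X
      ((\<lambda>(g, x). act g x) \<circ> (\<lambda>(g, y). (g, j y)))"
    by (rule continuous_map_compose) (use G in \<open>simp add: G_space_def\<close>)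
  then have "continuous_map (prod_topology euclidean Y) Y
      (i \<circ> ((\<lambda>(g, x). act g x) \<circ> (\<lambda>(g, y). (g, j y))))"
    using ci by (rule continuous_map_compose)
  then have "continuous_map (prod_topology euclidean Y) Y (\<lambda>(g, y). ?a g y)"
    by (simp add: comp_def case_prod_unfold)
  then have "G_space ?a Y"
    using G ji ij jY G_space_act_in[OF G] unfolding G_space_def by simp
  moreover have "topspace Y \<noteq> {}" using ne iX by blast
  moreover have "compact_space Y" "Hausdorff_space Y"
    using hs c H homeomorphic_compact_space homeomorphic_Hausdorff_space by blast+
  moreover have "G_minimal ?a Y"
    unfolding G_minimal_def
  proof (intro allI impI)
    fix C assume C: "closedin Y C \<and> G_invariant ?a C \<and> C \<noteq> {}"
    let ?D = "{x \<in> topspace X. i x \<in> C}"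
    have CY: "C \<subseteq> topspace Y" using C closedin_subset by blast
    have "closedin X ?D"
      using ci C closedin_continuous_map_preimage by blast
    moreover have "G_invariant act ?D"
      using C ji G_space_act_in[OF G] unfolding G_invariant_def by fastforce
    moreover have "?D \<noteq> {}"
      using C CY ij jY by fastforce
    ultimately have "?D = topspace X"
      using min unfolding G_minimal_def by blast
    then have "y \<in> C" if "y \<in> topspace Y" for y
      using jY[OF that] ij[OF that] by force
    then show "C = topspace Y" using CY by blast
  qed
  ultimately show ?thesis unfolding minimal_compact_G_space_def by blast
qed

lemma universal_minimal_compact_G_space_onto:
  fixes act :: "'g::topological_group_add \<Rightarrow> 'm \<Rightarrow> 'm" and act' :: "'g \<Rightarrow> 'x \<Rightarrow> 'x"
  assumes U: "universal_minimal_compact_G_space act M" and X: "minimal_compact_G_space act' X"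
  shows "\<exists>f. G_map act M act' X f \<and> f ` topspace M = topspace X"
proof -
  obtain i :: "'x \<Rightarrow> 'g set set" and Y j where hm: "homeomorphic_maps X Y i j"
    using minimal_embedding[OF X] homeomorphic_copy by blast
  have G: "G_space act' X" using X unfolding minimal_compact_G_space_def by auto
  have cj: "continuous_map Y X j"
    and ji: "\<And>x. x \<in> topspace X \<Longrightarrow> j (i x) = x"
    and ci: "continuous_map X Y i"
    using hm unfolding homeomorphic_maps_def by auto
  obtain f where f: "G_map act M (\<lambda>g y. i (act' g (j y))) Y f" "f ` topspace M = topspace Y"
    using U minimal_compact_G_space_transport[OF X hm]
    unfolding universal_minimal_compact_G_space_def by blast
  have jY: "j ` topspace Y = topspace X"
    using cj ci ji unfolding continuous_map_def by (force simp: image_iff Pi_iff)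
  have "continuous_map M X (j \<circ> f)"
    using f(1) cj continuous_map_compose unfolding G_map_def by blast
  moreover have "(j \<circ> f) (act g x) = act' g ((j \<circ> f) x)" if "x \<in> topspace M" for g x
  proof -
    have "j (f x) \<in> topspace X" using that f(2) jY by blast
    then show ?thesis
      using f(1) that ji G_space_act_in[OF G] unfolding G_map_def by simp
  qed
  moreover have "(j \<circ> f) ` topspace M = topspace X"
    using f(2) jY by (metis image_comp)
  ultimately show ?thesis unfolding G_map_def by blast
qed

end

(* Let M be the universal minimal G-space. Maximal chains of closed subsets of M lie in a closed
   invariant set of closed chains of the iterated Vietoris hyperspace of M (Uspenskij uses the set of
   all maximal chains; here maximality is weakened to a separation property that is visibly
   closed). This set is a compact G-space, so by universality M maps equivariantly to it. The image
   of a point p is a chain invariant under the stabiliser of p. If the action were 3-transitive,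
   any two points other than p could be interchanged by this stabiliser, so every member of the
   chain would contain all points other than p or none of them: such a chain separates no two of
   these points. *)

theory Submission
  imports Defs
begin

section \<open>The Vietoris topology on closed sets: compactness and separation\<close>

definition hit :: "'x topology \<Rightarrow> 'x set \<Rightarrow> 'x set set" where
  "hit X U = {F. closedin X F \<and> F \<inter> U \<noteq> {}}"

definition inside :: "'x topology \<Rightarrow> 'x set \<Rightarrow> 'x set set" where
  "inside X U = {F. closedin X F \<and> F \<subseteq> U}"

definition Vietoris_subbase :: "'x topology \<Rightarrow> 'x set set set" where
  "Vietoris_subbase X = hit X ` {U. openin X U} \<union> inside X ` {U. openin X U}"

text \<open>The empty closed set is admitted; it is an isolated point of the hyperspace.\<close>

definition Vietoris :: "'x topology \<Rightarrow> 'x set topology" where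
  "Vietoris X = topology (arbitrary union_of
     (finite intersection_of (\<lambda>\<U>. \<U> \<in> Vietoris_subbase X) relative_to {F. closedin X F}))"

lemma topspace_Vietoris [simp]: "topspace (Vietoris X) = {F. closedin X F}"
  unfolding Vietoris_def by simp

lemma openin_Vietoris_subbase:
  assumes "\<U> \<in> Vietoris_subbase X"
  shows "openin (Vietoris X) \<U>"
proof -
  have "\<U> \<subseteq> {F. closedin X F}"
    using assms unfolding Vietoris_subbase_def hit_def inside_def by auto
  then show ?thesis
    using assms unfolding Vietoris_def
    by (simp add: arbitrary_union_of_inc finite_intersection_of_inc openin_subbase
        relative_to_subset_inc)
qed

lemma openin_hit: "openin X U \<Longrightarrow> openin (Vietoris X) (hit X U)"
  by (rule openin_Vietoris_subbase) (simp add: Vietoris_subbase_def)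

lemma openin_inside: "openin X U \<Longrightarrow> openin (Vietoris X) (inside X U)"
  by (rule openin_Vietoris_subbase) (simp add: Vietoris_subbase_def)

text \<open>The complement consists of the closed sets contained in the open set
  \<open>topspace X - K\<close>. Together with \<open>closedin_missing\<close> this supplies the
  closed conditions from which separation of points by a chain is built.\<close>

lemma closedin_meeting:
  assumes "closedin X K"
  shows "closedin (Vietoris X) {F. closedin X F \<and> F \<inter> K \<noteq> {}}"
proof -
  have eq: "topspace (Vietoris X) - {F. closedin X F \<and> F \<inter> K \<noteq> {}} = inside X (topspace X - K)"
    unfolding inside_def using closedin_subset by fastforce
  show ?thesis
    unfolding closedin_def[of "Vietoris X"] eq using assms by (auto intro: openin_inside)
qed

lemma closedin_missing:
  assumes "openin X U"
  shows "closedin (Vietoris X) {F. closedin X F \<and> F \<inter> U = {}}"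
proof -
  have eq: "topspace (Vietoris X) - {F. closedin X F \<and> F \<inter> U = {}} = hit X U"
    unfolding hit_def by auto
  show ?thesis
    unfolding closedin_def[of "Vietoris X"] eq using openin_hit[OF assms] by auto
qed

text \<open>By Alexander's subbase theorem only covers by sets \<open>hit X U\<close> and
  \<open>inside X V\<close> matter. A suitable test set forces some \<open>inside X V\<close> into
  the cover; closed sets not inside \<open>V\<close> meet the compact set
  \<open>topspace X - V\<close>, which finitely many of the \<open>U\<close> cover.\<close>

lemma compact_space_Vietoris:
  assumes "compact_space X"
  shows "compact_space (Vietoris X)"
proof (rule Alexander_subbase_alt[where \<B> = "Vietoris_subbase X" and U = "{F. closedin X F}"])
  have "inside X (topspace X) = {F. closedin X F}"
    unfolding inside_def using closedin_subset by auto
  then show "{F. closedin X F} \<subseteq> \<Union> (Vietoris_subbase X)"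
    unfolding Vietoris_subbase_def by auto
next
  fix \<C> assume \<C>: "\<C> \<subseteq> Vietoris_subbase X" and cov: "{F. closedin X F} \<subseteq> \<Union>\<C>"
  define \<U> where "\<U> = {U. openin X U \<and> hit X U \<in> \<C>}"
  \<comment> \<open>The largest closed set that lies in none of the \<open>hit\<close> sets of the
    cover, so the member of the cover containing it must be an \<open>inside\<close> set.\<close>
  let ?F = "topspace X - \<Union>\<U>"
  have "closedin X ?F"
    unfolding \<U>_def by (intro closedin_diff openin_Union) auto
  then obtain \<W> where \<W>: "\<W> \<in> \<C>" "?F \<in> \<W>" using cov by auto
  have "\<W> \<noteq> hit X U" if "openin X U" for U
    using \<W> that unfolding \<U>_def hit_def by auto
  then obtain V where V: "openin X V" "\<W> = inside X V"
    using \<W> \<C> unfolding Vietoris_subbase_def by blast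
  then have "?F \<subseteq> V" using \<W> unfolding inside_def by auto
  then have "topspace X - V \<subseteq> \<Union>\<U>" by auto
  moreover have "compactin X (topspace X - V)"
    using assms V(1) by (intro closedin_compact_space) auto
  moreover have "\<And>U. U \<in> \<U> \<Longrightarrow> openin X U" unfolding \<U>_def by auto
  ultimately obtain \<F> where \<F>: "finite \<F>" "\<F> \<subseteq> \<U>" "topspace X - V \<subseteq> \<Union>\<F>"
    by (meson compactinD)
  have "{F. closedin X F} \<subseteq> \<Union> (insert \<W> (hit X ` \<F>))"
  proof
    fix E assume "E \<in> {F. closedin X F}"
    then have E: "closedin X E" "E \<subseteq> topspace X" using closedin_subset by auto
    show "E \<in> \<Union> (insert \<W> (hit X ` \<F>))"
    proof (cases "E \<subseteq> V")
      case True
      then show ?thesis using E V unfolding inside_def by auto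
    next
      case False
      then obtain x U where "x \<in> E" "U \<in> \<F>" "x \<in> U" using E \<F>(3) by blast
      then show ?thesis using E unfolding hit_def by auto
    qed
  qed
  moreover have "insert \<W> (hit X ` \<F>) \<subseteq> \<C>"
    using \<W> \<F> unfolding \<U>_def by auto
  ultimately show "\<exists>\<C>'. finite \<C>' \<and> \<C>' \<subseteq> \<C> \<and> {F. closedin X F} \<subseteq> \<Union>\<C>'"
    using \<F>(1) by (meson finite_imageI finite_insert)
qed (simp add: Vietoris_def)

text \<open>Non-inclusion is an open condition on pairs: a point of \<open>E\<close> outside
  \<open>F\<close> has a neighbourhood \<open>U\<close> disjoint from a neighbourhood
  \<open>V\<close> of \<open>F\<close>, and no set meeting \<open>U\<close> is contained in a set
  inside \<open>V\<close>. Used for the Hausdorff property and for comparability in chains.\<close>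

lemma Vietoris_separate_not_subset:
  assumes X: "compact_space X" "Hausdorff_space X"
    and E: "closedin X E" and F: "closedin X F" and "\<not> E \<subseteq> F"
  obtains \<U> \<V> where "openin (Vietoris X) \<U>" "openin (Vietoris X) \<V>" "E \<in> \<U>" "F \<in> \<V>"
    "\<And>E' F'. E' \<in> \<U> \<Longrightarrow> F' \<in> \<V> \<Longrightarrow> \<not> E' \<subseteq> F'"
proof -
  obtain x where x: "x \<in> E" "x \<notin> F" using assms by blast
  then have "x \<in> topspace X" using E closedin_subset by blast
  then obtain U V where UV: "openin X U" "openin X V" "{x} \<subseteq> U" "F \<subseteq> V" "disjnt U V"
    using Hausdorff_space_compact_separation[OF X(2), of "{x}" F] x
      closedin_compact_space[OF X(1) F] by auto
  show thesis
  proof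
    show "openin (Vietoris X) (hit X U)" "openin (Vietoris X) (inside X V)"
      using UV openin_hit openin_inside by auto
    show "E \<in> hit X U" "F \<in> inside X V"
      using UV x E F unfolding hit_def inside_def by auto
    show "\<And>E' F'. E' \<in> hit X U \<Longrightarrow> F' \<in> inside X V \<Longrightarrow> \<not> E' \<subseteq> F'"
      using UV(5) unfolding hit_def inside_def disjnt_def by blast
  qed
qed

lemma Hausdorff_space_Vietoris:
  assumes "compact_space X" "Hausdorff_space X"
  shows "Hausdorff_space (Vietoris X)"
proof -
  \<comment> \<open>A common element of \<open>\<U>\<close> and \<open>\<V>\<close> would fail to be
    included in itself.\<close>
  have sep: "\<exists>\<U> \<V>. openin (Vietoris X) \<U> \<and> openin (Vietoris X) \<V> \<and> E \<in> \<U> \<and> F \<in> \<V> \<and> disjnt \<U> \<V>"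
    if "closedin X E" "closedin X F" "\<not> E \<subseteq> F" for E F
    using Vietoris_separate_not_subset[OF assms that] unfolding disjnt_def by (metis disjoint_iff order_refl)
  show ?thesis
    unfolding Hausdorff_space_def
  proof (intro allI impI)
    fix E F assume EF: "E \<in> topspace (Vietoris X) \<and> F \<in> topspace (Vietoris X) \<and> E \<noteq> F"
    then consider "\<not> E \<subseteq> F" | "\<not> F \<subseteq> E" by blast
    then show "\<exists>\<U> \<V>. openin (Vietoris X) \<U> \<and> openin (Vietoris X) \<V> \<and> E \<in> \<U> \<and> F \<in> \<V> \<and> disjnt \<U> \<V>"
    proof cases
      case 1
      then show ?thesis using sep EF by simp
    next
      case 2
      then show ?thesis using sep[of F E] EF disjnt_sym by (metis mem_Collect_eq topspace_Vietoris)
    qed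
  qed
qed

section \<open>The induced action on the hyperspace\<close>

lemma G_space_act_add:
  "G_space act X \<Longrightarrow> x \<in> topspace X \<Longrightarrow> act g (act h x) = act (g + h) x"
  unfolding G_space_def by blast

lemma G_space_act_0: "G_space act X \<Longrightarrow> x \<in> topspace X \<Longrightarrow> act 0 x = x"
  unfolding G_space_def by blast

lemma G_space_act_minus:
  assumes "G_space act X" "x \<in> topspace X"
  shows "act (- g) (act g x) = x" "act g (act (- g) x) = x"
  using assms by (simp_all add: G_space_act_add G_space_act_0)

text \<open>Rewriting an image as a preimage under the inverse turns continuity of
  \<open>act (- g)\<close> into closedness of translates.\<close>

lemma G_space_image_act_eq:
  assumes G: "G_space act X" and F: "F \<subseteq> topspace X"
  shows "act g ` F = {x \<in> topspace X. act (- g) x \<in> F}"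
proof (intro set_eqI iffI)
  fix y assume "y \<in> act g ` F"
  then show "y \<in> {x \<in> topspace X. act (- g) x \<in> F}"
    using F G_space_act_in[OF G] G_space_act_minus(1)[OF G] by auto
next
  fix y assume y: "y \<in> {x \<in> topspace X. act (- g) x \<in> F}"
  then have "y = act g (act (- g) y)"
    using G_space_act_minus(2)[OF G] by simp
  then show "y \<in> act g ` F" using y by blast
qed

lemma G_space_closedin_act_image:
  assumes "G_space act X" "closedin X F"
  shows "closedin X (act g ` F)"
  using closedin_continuous_map_preimage[OF G_space_continuous_act[OF assms(1)] assms(2)]
    G_space_image_act_eq[OF assms(1) closedin_subset[OF assms(2)]] by metis

text \<open>Joint continuity is checked on the subbase. For \<open>hit\<close> a product
  neighbourhood of one pair \<open>(g, x)\<close> suffices; for \<open>inside\<close> the whole of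
  \<open>{g} \<times> F\<close> must be enclosed in an open box, which is where compactness
  enters.\<close>

lemma G_space_Vietoris:
  fixes act :: "'g::topological_group_add \<Rightarrow> 'x \<Rightarrow> 'x"
  assumes G: "G_space act X" and c: "compact_space X"
  shows "G_space (\<lambda>g F. act g ` F) (Vietoris X)"
proof -
  let ?P = "prod_topology (euclidean :: 'g topology) (Vietoris X)"
  let ?f = "\<lambda>(g, F). act g ` F"
  have pre: "openin (prod_topology euclidean X) {p \<in> UNIV \<times> topspace X. (\<lambda>(g, x). act g x) p \<in> U}"
    if "openin X U" for U
    using openin_continuous_map_preimage[OF _ that, of "prod_topology euclidean X" "\<lambda>(g, x). act g x"] G
    unfolding G_space_def by simp
  have "continuous_map ?P (Vietoris X) ?f"
    unfolding Vietoris_def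
  proof (rule continuous_map_into_topology_subbase, goal_cases)
    case (1 p)
    then show ?case
      using G_space_closedin_act_image[OF G] by (auto simp flip: Vietoris_def)
  next
    case (2 \<U>)
    then consider U where "openin X U" "\<U> = hit X U" | U where "openin X U" "\<U> = inside X U"
      unfolding Vietoris_subbase_def by auto
    then show ?case
    proof cases
      case (1 U)
      have "openin ?P {p \<in> topspace ?P. ?f p \<in> hit X U}"
      proof (subst openin_subopen, intro ballI)
        fix p assume "p \<in> {p \<in> topspace ?P. ?f p \<in> hit X U}"
        then obtain g F x where p: "p = (g, F)" "closedin X F" "x \<in> F" "act g x \<in> U"
          unfolding hit_def by auto
        then have "(g, x) \<in> {p \<in> UNIV \<times> topspace X. (\<lambda>(g, x). act g x) p \<in> U}"
          using closedin_subset by auto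
        then obtain A V where AV: "openin euclidean A" "openin X V" "g \<in> A" "x \<in> V"
          "A \<times> V \<subseteq> {p \<in> UNIV \<times> topspace X. (\<lambda>(g, x). act g x) p \<in> U}"
          using pre[OF 1(1)] unfolding openin_prod_topology_alt by meson
        have "A \<times> hit X V \<subseteq> {p \<in> topspace ?P. ?f p \<in> hit X U}"
          using AV(5) G_space_closedin_act_image[OF G] unfolding hit_def by fastforce
        moreover have "openin ?P (A \<times> hit X V)"
          using AV openin_hit[OF AV(2)] by (simp add: openin_prod_Times_iff)
        moreover have "p \<in> A \<times> hit X V"
          using AV p unfolding hit_def by auto
        ultimately show "\<exists>T. openin ?P T \<and> p \<in> T \<and> T \<subseteq> {p \<in> topspace ?P. ?f p \<in> hit X U}"
          by blast
      qed
      then show ?thesis using 1 by (simp flip: Vietoris_def)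
    next
      case (2 U)
      have "openin ?P {p \<in> topspace ?P. ?f p \<in> inside X U}"
      proof (subst openin_subopen, intro ballI)
        fix p assume "p \<in> {p \<in> topspace ?P. ?f p \<in> inside X U}"
        then obtain g F where p: "p = (g, F)" "closedin X F" "act g ` F \<subseteq> U"
          unfolding inside_def by auto
        then have "{g} \<times> F \<subseteq> {p \<in> UNIV \<times> topspace X. (\<lambda>(g, x). act g x) p \<in> U}"
          using closedin_subset by fastforce
        \<comment> \<open>The tube lemma for the compact sets \<open>{g}\<close> and
          \<open>F\<close>.\<close>
        then obtain A V where AV: "openin euclidean A" "openin X V" "{g} \<subseteq> A" "F \<subseteq> V"
          "A \<times> V \<subseteq> {p \<in> UNIV \<times> topspace X. (\<lambda>(g, x). act g x) p \<in> U}"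
          by (rule Wallace_theorem_prod_topology[OF _ closedin_compact_space[OF c p(2)] pre[OF 2(1)], rotated])
            (auto simp: compactin_sing)
        have "act h ` E \<subseteq> U" if "h \<in> A" "E \<subseteq> V" for h E
          using that AV(5) by fastforce
        then have "A \<times> inside X V \<subseteq> {p \<in> topspace ?P. ?f p \<in> inside X U}"
          using G_space_closedin_act_image[OF G] unfolding inside_def by auto
        moreover have "openin ?P (A \<times> inside X V)"
          using AV openin_inside[OF AV(2)] by (simp add: openin_prod_Times_iff)
        moreover have "p \<in> A \<times> inside X V"
          using AV p unfolding inside_def by auto
        ultimately show "\<exists>T. openin ?P T \<and> p \<in> T \<and> T \<subseteq> {p \<in> topspace ?P. ?f p \<in> inside X U}"
          by blast
      qed
      then show ?thesis using 2 by (simp flip: Vietoris_def)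
    qed
  qed
  moreover have "act g ` act h ` F = act (g + h) ` F" if "closedin X F" for g h F
    unfolding image_image
    by (rule image_cong) (use closedin_subset[OF that] G_space_act_add[OF G] in auto)
  moreover have "act 0 ` F = F" if "closedin X F" for F
  proof -
    have "act 0 x = x" if "x \<in> F" for x
      using that \<open>closedin X F\<close> closedin_subset G_space_act_0[OF G] by blast
    then show ?thesis by simp
  qed
  ultimately show ?thesis unfolding G_space_def by simp
qed

section \<open>Minimal subspaces of compact G-spaces\<close>

text \<open>Zorn's lemma is applied to the complements of the non-empty closed invariant subsets of
  \<open>\<Phi>\<close>. By compactness a chain of proper open sets cannot cover \<open>Y\<close>,
  so its union is an upper bound; the complement of a maximal element is minimal.\<close>

lemma exists_minimal_compact_G_subspace:
  assumes G: "G_space act Y" and Y: "compact_space Y" "Hausdorff_space Y"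
    and \<Phi>: "closedin Y \<Phi>" "G_invariant act \<Phi>" "\<Phi> \<noteq> {}"
  obtains S where "S \<subseteq> \<Phi>" "minimal_compact_G_space act (subtopology Y S)" "S \<subseteq> topspace Y"
proof -
  define \<A> where "\<A> = {T. openin Y T \<and> topspace Y - \<Phi> \<subseteq> T \<and> T \<noteq> topspace Y
    \<and> G_invariant act (topspace Y - T)}"
  have "\<exists>T\<in>\<A>. \<forall>T'\<in>\<A>. T \<subseteq> T' \<longrightarrow> T' = T"
  proof (rule subset_Zorn_nonempty)
    have "topspace Y - (topspace Y - \<Phi>) = \<Phi>"
      using \<Phi> closedin_subset by blast
    then have "topspace Y - \<Phi> \<in> \<A>"
      using \<Phi> unfolding \<A>_def by auto
    then show "\<A> \<noteq> {}" by blast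
  next
    fix \<C> assume ne: "\<C> \<noteq> {}" and ch: "subset.chain \<A> \<C>"
    then have sub: "\<C> \<subseteq> \<A>" by (simp add: subset_chain_def)
    have op: "openin Y T" "topspace Y - \<Phi> \<subseteq> T" "T \<noteq> topspace Y" "G_invariant act (topspace Y - T)"
      if "T \<in> \<C>" for T
      using sub that unfolding \<A>_def by auto
    have "\<Union>\<C> \<noteq> topspace Y"
    proof
      assume "\<Union>\<C> = topspace Y"
      then obtain \<F> where "finite \<F>" "\<F> \<subseteq> \<C>" "topspace Y \<subseteq> \<Union>\<F>"
        using compactinD[OF Y(1)[unfolded compact_space_def], of \<C>] op(1) by auto
      \<comment> \<open>A non-empty finite subfamily of a chain has its union as a member. The empty
        subfamily would make \<open>Y\<close> empty, against
        \<open>\<Phi> \<noteq> {}\<close>.\<close>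
      then have "\<F> = {} \<or> \<Union>\<F> \<in> \<C>"
        using Union_in_chain[OF \<open>finite \<F>\<close>] ch unfolding subset_chain_def by (meson subset_eq)
      then show False
      proof
        assume "\<F> = {}"
        then show False using \<open>topspace Y \<subseteq> \<Union>\<F>\<close> \<Phi>(1,3) closedin_subset by auto
      next
        assume "\<Union>\<F> \<in> \<C>"
        then show False
          using \<open>topspace Y \<subseteq> \<Union>\<F>\<close> op(1,3)[of "\<Union>\<F>"] openin_subset[of Y "\<Union>\<F>"] by blast
      qed
    qed
    moreover have "openin Y (\<Union>\<C>)" using op by blast
    moreover have "topspace Y - \<Phi> \<subseteq> \<Union>\<C>" using op ne by blast
    moreover have "G_invariant act (topspace Y - \<Union>\<C>)"
      using op(4) ne unfolding G_invariant_def by blast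
    ultimately show "\<Union>\<C> \<in> \<A>"
      unfolding \<A>_def by blast
  qed
  then obtain T where T: "T \<in> \<A>" and max: "\<And>T'. T' \<in> \<A> \<Longrightarrow> T \<subseteq> T' \<Longrightarrow> T' = T"
    by blast
  define S where "S = topspace Y - T"
  have S: "closedin Y S" "S \<noteq> {}" "G_invariant act S" "S \<subseteq> \<Phi>" "S \<subseteq> topspace Y"
    using T openin_subset unfolding S_def \<A>_def by auto
  have tS: "topspace (subtopology Y S) = S" using S by auto
  have "continuous_map (prod_topology euclidean (subtopology Y S)) Y (\<lambda>(g, x). act g x)"
    unfolding prod_topology_subtopology
    by (rule continuous_map_from_subtopology) (use G in \<open>simp add: G_space_def\<close>)
  then have "continuous_map (prod_topology euclidean (subtopology Y S)) (subtopology Y S) (\<lambda>(g, x). act g x)"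
    using S(3) unfolding G_invariant_def by (auto simp: continuous_map_in_subtopology)
  then have "G_space act (subtopology Y S)"
    using G S(5) unfolding G_space_def tS by auto
  moreover have "G_minimal act (subtopology Y S)"
    unfolding G_minimal_def tS
  proof (intro allI impI)
    fix C assume C: "closedin (subtopology Y S) C \<and> G_invariant act C \<and> C \<noteq> {}"
    then have CS: "closedin Y C" "C \<subseteq> S"
      using S(1) closedin_closed_subtopology by blast+
    have "topspace Y - C \<in> \<A>"
      using C CS S unfolding \<A>_def by (auto simp: double_diff)
    moreover have "T \<subseteq> topspace Y - C"
      using CS(2) T openin_subset[of Y T] unfolding S_def \<A>_def by blast
    ultimately have "topspace Y - C = T" by (rule max)
    then show "C = S" using CS S unfolding S_def by blast
  qed
  ultimately have "minimal_compact_G_space act (subtopology Y S)"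
    using S Y tS closedin_compact_space[OF Y(1) S(1)] unfolding minimal_compact_G_space_def
    by (auto simp: compact_space_subtopology Hausdorff_space_subtopology)
  then show thesis using that S by blast
qed

section \<open>The closed invariant set of separating chains\<close>

text \<open>Replacing a neighbourhood by the open \<open>U\<close> where a set must miss it and by the closed \<open>K\<close> where a
  set must meet it makes each condition closed in the Vietoris topology.\<close>

definition separating_chains :: "'x topology \<Rightarrow> 'x set set set" where
  "separating_chains X = {C. closedin (Vietoris X) C \<and> (\<forall>E\<in>C. \<forall>F\<in>C. E \<subseteq> F \<or> F \<subseteq> E) \<and>
     (\<forall>U V K L. openin X U \<and> openin X V \<and> closedin X K \<and> closedin X L \<and>
        U \<subseteq> K \<and> V \<subseteq> L \<and> U \<noteq> {} \<and> V \<noteq> {} \<and> U \<inter> V = {} \<longrightarrow>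
        (\<exists>F\<in>C. F \<inter> K \<noteq> {} \<and> F \<inter> V = {} \<or> F \<inter> L \<noteq> {} \<and> F \<inter> U = {}))}"

lemma separating_chains_total:
  "C \<in> separating_chains X \<Longrightarrow> E \<in> C \<Longrightarrow> F \<in> C \<Longrightarrow> E \<subseteq> F \<or> F \<subseteq> E"
  unfolding separating_chains_def by blast

lemma separating_chains_closedin:
  "C \<in> separating_chains X \<Longrightarrow> closedin (Vietoris X) C"
  unfolding separating_chains_def by blast

lemma separating_chains_member_closedin:
  "C \<in> separating_chains X \<Longrightarrow> F \<in> C \<Longrightarrow> closedin X F"
  using closedin_subset[OF separating_chains_closedin] by fastforce

lemma separating_chains_separate:
  assumes "C \<in> separating_chains X"
    and "openin X U" "openin X V" "closedin X K" "closedin X L"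
    and "U \<subseteq> K" "V \<subseteq> L" "U \<noteq> {}" "V \<noteq> {}" "U \<inter> V = {}"
  shows "\<exists>F\<in>C. F \<inter> K \<noteq> {} \<and> F \<inter> V = {} \<or> F \<inter> L \<noteq> {} \<and> F \<inter> U = {}"
  using assms unfolding separating_chains_def by blast

text \<open>A closed family can fail in two ways, and each persists nearby: it has two incomparable
  members, or some quadruple \<open>U\<close>, \<open>V\<close>, \<open>K\<close>, \<open>L\<close>
  is separated by none of its members.\<close>

lemma closedin_separating_chains:
  assumes X: "compact_space X" "Hausdorff_space X"
  shows "closedin (Vietoris (Vietoris X)) (separating_chains X)"
proof -
  let ?VV = "Vietoris (Vietoris X)"
  have "openin ?VV (topspace ?VV - separating_chains X)"
  proof (subst openin_subopen, intro ballI)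
    fix C assume "C \<in> topspace ?VV - separating_chains X"
    then have C: "closedin (Vietoris X) C" "C \<notin> separating_chains X" by auto
    have Cc: "closedin X F" if "F \<in> C" for F
      using closedin_subset[OF C(1)] that by auto
    have "(\<exists>E\<in>C. \<exists>F\<in>C. \<not> E \<subseteq> F \<and> \<not> F \<subseteq> E) \<or>
      (\<exists>U V K L. openin X U \<and> openin X V \<and> closedin X K \<and> closedin X L \<and>
        U \<subseteq> K \<and> V \<subseteq> L \<and> U \<noteq> {} \<and> V \<noteq> {} \<and> U \<inter> V = {} \<and>
        \<not> (\<exists>F\<in>C. F \<inter> K \<noteq> {} \<and> F \<inter> V = {} \<or> F \<inter> L \<noteq> {} \<and> F \<inter> U = {}))"
      using C unfolding separating_chains_def by auto
    then show "\<exists>T. openin ?VV T \<and> C \<in> T \<and> T \<subseteq> topspace ?VV - separating_chains X"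
    proof (elim disjE bexE exE)
      fix E F assume EF: "E \<in> C" "F \<in> C" "\<not> E \<subseteq> F \<and> \<not> F \<subseteq> E"
      obtain \<U> \<V> where 1: "openin (Vietoris X) \<U>" "openin (Vietoris X) \<V>" "E \<in> \<U>" "F \<in> \<V>"
        "\<And>E' F'. E' \<in> \<U> \<Longrightarrow> F' \<in> \<V> \<Longrightarrow> \<not> E' \<subseteq> F'"
        using Vietoris_separate_not_subset[OF X, of E F] Cc EF by metis
      obtain \<U>' \<V>' where 2: "openin (Vietoris X) \<U>'" "openin (Vietoris X) \<V>'" "F \<in> \<U>'" "E \<in> \<V>'"
        "\<And>E' F'. E' \<in> \<U>' \<Longrightarrow> F' \<in> \<V>' \<Longrightarrow> \<not> E' \<subseteq> F'"
        using Vietoris_separate_not_subset[OF X, of F E] Cc EF by metis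
      \<comment> \<open>The first open set is a neighbourhood of \<open>E\<close>, the second of
        \<open>F\<close>; any choice from the two is incomparable, since inclusion is excluded in
        both directions.\<close>
      let ?T = "hit (Vietoris X) (\<U> \<inter> \<V>') \<inter> hit (Vietoris X) (\<V> \<inter> \<U>')"
      have "openin ?VV ?T"
        using 1 2 by (intro openin_Int openin_hit)
      moreover have "C \<in> ?T"
        using 1 2 EF C unfolding hit_def by auto
      moreover have "D \<notin> separating_chains X" if D: "D \<in> ?T" for D
      proof -
        obtain E' F' where "E' \<in> D" "F' \<in> D" "E' \<in> \<U> \<inter> \<V>'" "F' \<in> \<V> \<inter> \<U>'"
          using D unfolding hit_def by blast
        then show ?thesis using 1(5) 2(5) separating_chains_total by fastforce
      qed
      moreover have "?T \<subseteq> topspace ?VV" unfolding hit_def by auto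
      ultimately show ?thesis by blast
    next
      fix U V K L assume UV: "openin X U \<and> openin X V \<and> closedin X K \<and> closedin X L \<and>
        U \<subseteq> K \<and> V \<subseteq> L \<and> U \<noteq> {} \<and> V \<noteq> {} \<and> U \<inter> V = {} \<and>
        \<not> (\<exists>F\<in>C. F \<inter> K \<noteq> {} \<and> F \<inter> V = {} \<or> F \<inter> L \<noteq> {} \<and> F \<inter> U = {})"
      let ?meet = "\<lambda>K. {F. closedin X F \<and> F \<inter> K \<noteq> {}}"
      let ?miss = "\<lambda>U. {F. closedin X F \<and> F \<inter> U = {}}"
      \<comment> \<open>The closed set of all \<open>F\<close> that separate this quadruple. The
        family \<open>C\<close> avoids it, and so does every family inside its open
        complement.\<close>
      let ?K = "?meet K \<inter> ?miss V \<union> ?meet L \<inter> ?miss U"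
      let ?T = "inside (Vietoris X) (topspace (Vietoris X) - ?K)"
      have "closedin (Vietoris X) ?K"
        using UV by (intro closedin_Un closedin_Int closedin_meeting closedin_missing) auto
      then have "openin ?VV ?T"
        by (intro openin_inside) blast
      moreover have "C \<in> ?T"
        using UV C(1) closedin_subset[OF C(1)] unfolding inside_def by blast
      moreover have "D \<notin> separating_chains X" if "D \<in> ?T" for D
      proof
        assume "D \<in> separating_chains X"
        then obtain F where "F \<in> D" "F \<inter> K \<noteq> {} \<and> F \<inter> V = {} \<or> F \<inter> L \<noteq> {} \<and> F \<inter> U = {}"
          using UV separating_chains_separate[of D X U V K L] by auto
        moreover have "D \<subseteq> topspace (Vietoris X) - ?K" using that unfolding inside_def by simp
        ultimately have "F \<in> topspace (Vietoris X) - ?K" "F \<in> ?K" by auto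
        then show False by (rule DiffD2)
      qed
      moreover have "?T \<subseteq> topspace ?VV" unfolding inside_def by auto
      ultimately show ?thesis by blast
    qed
  qed
  moreover have "separating_chains X \<subseteq> topspace ?VV"
    unfolding separating_chains_def by auto
  ultimately show ?thesis unfolding closedin_def[of ?VV] by simp
qed

text \<open>Since \<open>act g\<close> is a homeomorphism, a quadruple for the translated chain
  pulls back to a quadruple for \<open>C\<close>, and the translate of a member separating the
  latter separates the former.\<close>

lemma G_invariant_separating_chains:
  assumes G: "G_space act X" and c: "compact_space X"
  shows "G_invariant (\<lambda>g C. (\<lambda>F. act g ` F) ` C) (separating_chains X)"
  unfolding G_invariant_def
proof (intro allI ballI)
  fix g C assume C: "C \<in> separating_chains X"
  let ?C = "(\<lambda>F. act g ` F) ` C"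
  have "closedin (Vietoris X) ?C"
    using G_space_closedin_act_image[OF G_space_Vietoris[OF G c]] separating_chains_closedin[OF C]
    by blast
  moreover have "\<forall>E\<in>?C. \<forall>F\<in>?C. E \<subseteq> F \<or> F \<subseteq> E"
  proof (intro ballI)
    fix E' F' assume "E' \<in> ?C" "F' \<in> ?C"
    then obtain E F where "E \<in> C" "F \<in> C" "E' = act g ` E" "F' = act g ` F" by blast
    then show "E' \<subseteq> F' \<or> F' \<subseteq> E'"
      using separating_chains_total[OF C, of E F] image_mono by auto
  qed
  moreover have "\<exists>F\<in>?C. F \<inter> K \<noteq> {} \<and> F \<inter> V = {} \<or> F \<inter> L \<noteq> {} \<and> F \<inter> U = {}"
    if UV: "openin X U \<and> openin X V \<and> closedin X K \<and> closedin X L \<and>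
        U \<subseteq> K \<and> V \<subseteq> L \<and> U \<noteq> {} \<and> V \<noteq> {} \<and> U \<inter> V = {}" for U V K L
  proof -
    let ?p = "\<lambda>S. {x \<in> topspace X. act g x \<in> S}"
    have ca: "continuous_map X X (act g)" using G_space_continuous_act[OF G] .
    \<comment> \<open>Preimages stay non-empty because \<open>act g\<close> is onto, with inverse
      \<open>act (- g)\<close>.\<close>
    have ne: "?p S \<noteq> {}" if S: "openin X S" "S \<noteq> {}" for S
    proof -
      obtain s where s: "s \<in> S" "s \<in> topspace X" using S openin_subset by blast
      then have "act (- g) s \<in> ?p S"
        using G_space_act_in[OF G] G_space_act_minus(2)[OF G] by simp
      then show ?thesis by blast
    qed
    have "\<exists>F\<in>C. F \<inter> ?p K \<noteq> {} \<and> F \<inter> ?p V = {} \<or> F \<inter> ?p L \<noteq> {} \<and> F \<inter> ?p U = {}"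
    proof (rule separating_chains_separate[OF C])
      show "openin X (?p U)" "openin X (?p V)"
        using UV openin_continuous_map_preimage[OF ca] by blast+
      show "closedin X (?p K)" "closedin X (?p L)"
        using UV closedin_continuous_map_preimage[OF ca] by blast+
      show "?p U \<noteq> {}" "?p V \<noteq> {}" using UV ne by blast+
    qed (use UV in auto)
    then obtain F where F: "F \<in> C" "F \<inter> ?p K \<noteq> {} \<and> F \<inter> ?p V = {} \<or> F \<inter> ?p L \<noteq> {} \<and> F \<inter> ?p U = {}"
      by blast
    have "F \<subseteq> topspace X"
      using separating_chains_member_closedin[OF C F(1)] closedin_subset by blast
    then have "act g ` F \<inter> S = {} \<longleftrightarrow> F \<inter> ?p S = {}" for S by blast
    then have "act g ` F \<inter> K \<noteq> {} \<and> act g ` F \<inter> V = {} \<or> act g ` F \<inter> L \<noteq> {} \<and> act g ` F \<inter> U = {}"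
      using F(2) by simp
    then show ?thesis using F(1) by (rule bexI[OF _ imageI])
  qed
  ultimately show "?C \<in> separating_chains X"
    unfolding separating_chains_def by (intro CollectI conjI allI impI)
qed

section \<open>Existence of a separating chain\<close>

text \<open>A maximal chain separates: if \<open>A\<close> is its largest member missing \<open>U \<union> V\<close> and \<open>B\<close> is the
  intersection of the others, then \<open>B\<close> has at most one more point than \<open>A\<close>, so it cannot meet
  both \<open>U\<close> and \<open>V\<close>.\<close>

lemma separating_chains_nonempty:
  assumes X: "compact_space X" "Hausdorff_space X"
  shows "separating_chains X \<noteq> {}"
proof -
  obtain C where "subset.maxchain {F. closedin X F} C"
    using subset.Hausdorff by blast
  then have chain: "subset.chain {F. closedin X F} C"
    and no_super: "\<And>D. subset.chain {F. closedin X F} D \<Longrightarrow> \<not> C \<subset> D"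
    unfolding subset.maxchain_def by blast+
  have Cc: "\<And>F. F \<in> C \<Longrightarrow> closedin X F" and tot: "\<And>E F. E \<in> C \<Longrightarrow> F \<in> C \<Longrightarrow> E \<subseteq> F \<or> F \<subseteq> E"
    using chain unfolding subset_chain_def by auto
  \<comment> \<open>Maximality in usable form: a closed set comparable with every member is itself a
    member.\<close>
  have max: "F \<in> C" if "closedin X F" "\<And>E. E \<in> C \<Longrightarrow> E \<subseteq> F \<or> F \<subseteq> E" for F
  proof -
    have "subset.chain {F. closedin X F} (insert F C)"
      using that Cc tot unfolding subset_chain_def by auto
    then show ?thesis using no_super by blast
  qed
  have top: "topspace X \<in> C"
    using Cc closedin_subset by (intro max) auto
  \<comment> \<open>By maximality a closed \<open>F\<close> outside \<open>C\<close> is incomparable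
    with some \<open>E\<close> in \<open>C\<close>, and closed sets near \<open>F\<close> remain
    incomparable with this \<open>E\<close>.\<close>
  have "openin (Vietoris X) (topspace (Vietoris X) - C)"
  proof (subst openin_subopen, intro ballI)
    fix F assume F: "F \<in> topspace (Vietoris X) - C"
    then obtain E where E: "E \<in> C" "\<not> E \<subseteq> F" "\<not> F \<subseteq> E" using max[of F] by auto
    have Fc: "closedin X F" using F by simp
    obtain \<U> \<V> where 1: "openin (Vietoris X) \<V>" "E \<in> \<U>" "F \<in> \<V>"
      "\<And>E' F'. E' \<in> \<U> \<Longrightarrow> F' \<in> \<V> \<Longrightarrow> \<not> E' \<subseteq> F'"
      using Vietoris_separate_not_subset[OF X Cc[OF E(1)] Fc E(2)] by metis
    obtain \<U>' \<V>' where 2: "openin (Vietoris X) \<U>'" "F \<in> \<U>'" "E \<in> \<V>'"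
      "\<And>E' F'. E' \<in> \<U>' \<Longrightarrow> F' \<in> \<V>' \<Longrightarrow> \<not> E' \<subseteq> F'"
      using Vietoris_separate_not_subset[OF X Fc Cc[OF E(1)] E(3)] by metis
    have "openin (Vietoris X) (\<V> \<inter> \<U>')" using 1 2 by blast
    moreover have "\<V> \<inter> \<U>' \<subseteq> topspace (Vietoris X) - C"
      using 1 2 E(1) tot openin_subset by blast
    ultimately show "\<exists>T. openin (Vietoris X) T \<and> F \<in> T \<and> T \<subseteq> topspace (Vietoris X) - C"
      using 1 2 by blast
  qed
  then have "closedin (Vietoris X) C"
    using Cc unfolding closedin_def[of "Vietoris X"] by auto
  moreover have "\<exists>F\<in>C. F \<inter> K \<noteq> {} \<and> F \<inter> V = {} \<or> F \<inter> L \<noteq> {} \<and> F \<inter> U = {}"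
    if UV: "openin X U \<and> openin X V \<and> closedin X K \<and> closedin X L \<and>
        U \<subseteq> K \<and> V \<subseteq> L \<and> U \<noteq> {} \<and> V \<noteq> {} \<and> U \<inter> V = {}" for U V K L
  proof (rule ccontr)
    assume neg: "\<not> ?thesis"
    \<comment> \<open>The union itself might not be closed; its closure still misses
      \<open>U \<union> V\<close>, because that set is open.\<close>
    define A where "A = X closure_of \<Union>{F \<in> C. F \<inter> (U \<union> V) = {}}"
    define D where "D = {F \<in> C. F \<inter> (U \<union> V) \<noteq> {}}"
    define B where "B = \<Inter>D"
    have lowA: "E \<subseteq> A" if "E \<in> C" "E \<inter> (U \<union> V) = {}" for E
    proof -
      have "E \<subseteq> \<Union>{F \<in> C. F \<inter> (U \<union> V) = {}}" using that by blast
      moreover have "\<Union>{F \<in> C. F \<inter> (U \<union> V) = {}} \<subseteq> topspace X" using Cc closedin_subset by blast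
      ultimately show ?thesis unfolding A_def using closure_of_subset by blast
    qed
    have AE: "A \<subseteq> E" if "E \<in> D" for E
      unfolding A_def
    proof (rule closure_of_minimal)
      show "\<Union>{F \<in> C. F \<inter> (U \<union> V) = {}} \<subseteq> E"
        using that tot unfolding D_def by blast
      show "closedin X E" using that Cc unfolding D_def by blast
    qed
    have Amiss: "A \<inter> (U \<union> V) = {}"
      unfolding A_def using UV by (subst Int_commute, subst openin_Int_closure_of_eq_empty) auto
    have topD: "topspace X \<in> D"
      using top UV openin_subset unfolding D_def by blast
    have Bc: "closedin X B"
      unfolding B_def using topD Cc by (intro closedin_Inter) (auto simp: D_def)
    have "B \<in> C"
    proof (rule max[OF Bc])
      fix E assume "E \<in> C"
      then show "E \<subseteq> B \<or> B \<subseteq> E"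
        using lowA AE unfolding B_def D_def by blast
    qed
    \<comment> \<open>Compactness applies only to closed traces, so \<open>U \<union> V\<close> is
      enlarged to \<open>K \<union> L\<close>. The traces form a chain of non-empty sets, hence a
      finite non-empty subfamily has a smallest trace as its intersection.\<close>
    have "\<Inter>((\<lambda>F. F \<inter> (K \<union> L)) ` D) \<noteq> {}"
    proof -
      have "\<Inter>\<F> \<noteq> {}" if \<F>: "finite \<F>" "\<F> \<subseteq> (\<lambda>F. F \<inter> (K \<union> L)) ` D" for \<F>
      proof (cases "\<F> = {}")
        case False
        have "\<Inter>\<F> \<in> \<F>"
        proof (rule Inter_in_chain[OF \<F>(1) False])
          show "subset.chain UNIV \<F>"
            unfolding subset_chain_def
          proof (intro conjI ballI)
            fix S T assume "S \<in> \<F>" "T \<in> \<F>"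
            then have "S \<in> (\<lambda>F. F \<inter> (K \<union> L)) ` D" "T \<in> (\<lambda>F. F \<inter> (K \<union> L)) ` D"
              using \<F>(2) by (simp_all add: subset_iff)
            then obtain E F where "S = E \<inter> (K \<union> L)" "T = F \<inter> (K \<union> L)" "E \<in> C" "F \<in> C"
              unfolding D_def by (elim imageE) simp
            then show "S \<subseteq> T \<or> T \<subseteq> S" using tot[of E F] by blast
          qed simp
        qed
        then have "\<Inter>\<F> \<in> (\<lambda>F. F \<inter> (K \<union> L)) ` D"
          using \<F>(2) by (rule subsetD[rotated])
        then obtain E where "E \<in> D" "\<Inter>\<F> = E \<inter> (K \<union> L)" by (elim imageE)
        then show ?thesis using UV unfolding D_def by auto
      qed simp
      moreover have "\<forall>T\<in>(\<lambda>F. F \<inter> (K \<union> L)) ` D. closedin X T"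
        using Cc UV unfolding D_def by auto
      ultimately show ?thesis
        using X(1)[unfolded compact_space_fip, rule_format, of "(\<lambda>F. F \<inter> (K \<union> L)) ` D"] by simp
    qed
    then have "B \<inter> (K \<union> L) \<noteq> {}"
      using topD unfolding B_def by blast
    then have "B \<inter> K \<noteq> {} \<or> B \<inter> L \<noteq> {}" by blast
    \<comment> \<open>As \<open>B\<close> does not separate, meeting \<open>K\<close> forces meeting
      \<open>V\<close>, and meeting \<open>L\<close> forces meeting \<open>U\<close>. So
      \<open>B\<close> meets both open sets, although only \<open>K \<union> L\<close> was known to
      meet it.\<close>
    moreover have "B \<inter> K \<noteq> {} \<longrightarrow> B \<inter> V \<noteq> {}" "B \<inter> L \<noteq> {} \<longrightarrow> B \<inter> U \<noteq> {}"
      using neg \<open>B \<in> C\<close> by blast+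
    moreover have "B \<inter> U \<subseteq> B \<inter> K" "B \<inter> V \<subseteq> B \<inter> L" using UV by blast+
    ultimately have "B \<inter> U \<noteq> {}" "B \<inter> V \<noteq> {}" by auto
    then obtain u v where uv: "u \<in> B" "u \<in> U" "v \<in> B" "v \<in> V" by blast
    \<comment> \<open>Members missing \<open>U \<union> V\<close> lie in \<open>A\<close>; all
      others contain \<open>A\<close> and, through \<open>B\<close>, the point
      \<open>u\<close>.\<close>
    have "insert u A \<in> C"
    proof (rule max)
      have "closedin X ({u} \<union> A)"
        unfolding A_def using uv(1) Bc closedin_subset X(2)
        by (intro closedin_Un closedin_Hausdorff_singleton) auto
      then show "closedin X (insert u A)" by simp
      fix E assume "E \<in> C"
      then show "E \<subseteq> insert u A \<or> insert u A \<subseteq> E"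
        using lowA AE uv(1) unfolding B_def D_def by blast
    qed
    \<comment> \<open>As a member meeting \<open>U\<close>, this set contains \<open>B\<close> and
      therefore \<open>v\<close>, which is neither \<open>u\<close> nor in \<open>A\<close>.\<close>
    then have "insert u A \<in> D" using uv unfolding D_def by blast
    then have "v \<in> insert u A" using uv unfolding B_def by blast
    moreover have "v \<noteq> u" using uv UV by (metis IntI empty_iff)
    moreover have "v \<notin> A" using uv(4) Amiss by auto
    ultimately show False by simp
  qed
  ultimately have "C \<in> separating_chains X"
    using tot unfolding separating_chains_def by simp
  then show ?thesis by blast
qed

section \<open>Interchanging points contradicts separation\<close>

text \<open>If \<open>a\<close> lies in a member \<open>F\<close> of the chain but \<open>b\<close> does not, an element interchanging
  \<open>a\<close> and \<open>b\<close> sends \<open>F\<close> to a set that is not comparable with \<open>F\<close>.\<close>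

lemma separating_chain_not_swappable:
  assumes G: "G_space act X" and H: "Hausdorff_space X" and C: "C \<in> separating_chains X"
    and swap: "\<And>a b. \<lbrakk>a \<in> topspace X - {p}; b \<in> topspace X - {p}; a \<noteq> b\<rbrakk> \<Longrightarrow>
      \<exists>g. (\<lambda>F. act g ` F) ` C \<subseteq> C \<and> act g a = b \<and> act g b = a"
    and p: "p \<in> topspace X" and a: "a \<in> topspace X - {p}" and b: "b \<in> topspace X - {p}"
    and "a \<noteq> b"
  shows False
proof -
  have all: "y \<in> F" if F: "F \<in> C" and x: "x \<in> F" "x \<noteq> p" and y: "y \<in> topspace X - {p}" for F x y
  proof (rule ccontr)
    assume yF: "y \<notin> F"
    have FX: "F \<subseteq> topspace X"
      using separating_chains_member_closedin[OF C F] closedin_subset by blast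
    obtain g where g: "(\<lambda>F. act g ` F) ` C \<subseteq> C" "act g x = y" "act g y = x"
      using swap[of x y] x y yF FX by blast
    \<comment> \<open>By injectivity only \<open>y\<close> is sent to \<open>x\<close>, and
      \<open>y\<close> is not in \<open>F\<close>.\<close>
    have "x \<notin> act g ` F"
    proof
      assume "x \<in> act g ` F"
      then obtain z where z: "z \<in> F" "act g z = act g y" using g(3) by auto
      then have "z = y" using G_space_act_minus(1)[OF G, of _ g] FX y by (metis DiffD1 subsetD)
      then show False using z yF by simp
    qed
    moreover have "y \<in> act g ` F" using x g(2) by blast
    moreover have "act g ` F \<in> C" using g(1) F by blast
    ultimately show False
      using separating_chains_total[OF C F] x yF by blast
  qed
  have fin: "compactin X {x, p}" if "x \<in> topspace X" for x
    using that p by (intro finite_imp_compactin) auto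
  obtain U U' where U: "openin X U" "openin X U'" "{a} \<subseteq> U" "{b, p} \<subseteq> U'" "disjnt U U'"
    using Hausdorff_space_compact_separation[OF H _ fin, of "{a}" b] a b \<open>a \<noteq> b\<close> by auto
  obtain V V' where V: "openin X V" "openin X V'" "{b} \<subseteq> V" "{a, p} \<subseteq> V'" "disjnt V V'"
    using Hausdorff_space_compact_separation[OF H _ fin, of "{b}" a] a b \<open>a \<noteq> b\<close> by auto
  \<comment> \<open>The open sets are neighbourhoods of \<open>a\<close> and \<open>b\<close>. Their
    closed enlargements \<open>topspace X - U'\<close> and \<open>topspace X - V'\<close> both
    exclude \<open>p\<close>, so a separating member contains a point other than
    \<open>p\<close>.\<close>
  have "\<exists>F\<in>C. F \<inter> (topspace X - U') \<noteq> {} \<and> F \<inter> (V \<inter> U') = {} \<or>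
      F \<inter> (topspace X - V') \<noteq> {} \<and> F \<inter> U = {}"
  proof (rule separating_chains_separate[OF C])
    show "U \<subseteq> topspace X - U'"
      using U(5) openin_subset[OF U(1)] unfolding disjnt_def by blast
    show "V \<inter> U' \<subseteq> topspace X - V'"
      using V(5) openin_subset[OF V(1)] unfolding disjnt_def by blast
    show "U \<noteq> {}" "V \<inter> U' \<noteq> {}" using U V by auto
    show "U \<inter> (V \<inter> U') = {}" using U unfolding disjnt_def by blast
  qed (use U V in auto)
  then obtain F where F: "F \<in> C"
    "F \<inter> (topspace X - U') \<noteq> {} \<and> F \<inter> (V \<inter> U') = {} \<or> F \<inter> (topspace X - V') \<noteq> {} \<and> F \<inter> U = {}"
    by blast
  then obtain x where "x \<in> F" "x \<noteq> p" using U V by blast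
  \<comment> \<open>Then \<open>F\<close> meets both \<open>U\<close> and
    \<open>V \<inter> U'\<close>, contrary to either alternative.\<close>
  then have "a \<in> F" "b \<in> F" using all[OF F(1)] a b by blast+
  then show False using F U V by blast
qed

theorem theorem1p1:
  fixes act :: "'g::topological_group_add \<Rightarrow> 'm \<Rightarrow> 'm" and M :: "'m topology"
  assumes "universal_minimal_compact_G_space act M"
  shows "\<not> three_transitive act (topspace M)"
proof
  assume three: "three_transitive act (topspace M)"
  have G: "G_space act M" and c: "compact_space M" and H: "Hausdorff_space M"
    using assms unfolding universal_minimal_compact_G_space_def minimal_compact_G_space_def by blast+
  let ?act = "\<lambda>g C. (\<lambda>F. act g ` F) ` C"
  let ?Y = "Vietoris (Vietoris M)"
  note cV = compact_space_Vietoris[OF c] and HV = Hausdorff_space_Vietoris[OF c H]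
  have "G_space ?act ?Y"
    using G_space_Vietoris[OF G_space_Vietoris[OF G c] cV] .
  then obtain S where S: "S \<subseteq> separating_chains M"
    "minimal_compact_G_space ?act (subtopology ?Y S)" "S \<subseteq> topspace ?Y"
    using exists_minimal_compact_G_subspace[OF _ compact_space_Vietoris[OF cV]
        Hausdorff_space_Vietoris[OF cV HV] closedin_separating_chains[OF c H]
        G_invariant_separating_chains[OF G c] separating_chains_nonempty[OF c H]] by metis
  \<comment> \<open>Points of \<open>S\<close> are chains of type \<open>'m set set\<close>, so
    universality is used in its form for arbitrary carrier types.\<close>
  obtain f where f: "G_map act M ?act (subtopology ?Y S) f" "f ` topspace M = topspace (subtopology ?Y S)"
    using universal_minimal_compact_G_space_onto[OF assms S(2)] by blast
  obtain T where T: "T \<subseteq> topspace M" "card T = 3"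
    using three unfolding three_transitive_def by blast
  then obtain p a b where pab: "T = {p, a, b}" "p \<noteq> a" "p \<noteq> b" "a \<noteq> b"
    by (metis card_3_iff)
  have p: "p \<in> topspace M" using T pab by blast
  have sep: "f p \<in> separating_chains M"
    using f(2) p S by auto
  \<comment> \<open>The triple \<open>(p, x, y)\<close> is moved to \<open>(p, y, x)\<close>; the
    element doing so fixes \<open>p\<close>, hence by equivariance it fixes the chain
    \<open>f p\<close>.\<close>
  have swap: "\<exists>g. ?act g (f p) \<subseteq> f p \<and> act g x = y \<and> act g y = x"
    if "x \<in> topspace M - {p}" "y \<in> topspace M - {p}" "x \<noteq> y" for x y
  proof -
    have "distinct [p, x, y] \<and> distinct [p, y, x]" "x \<in> topspace M" "y \<in> topspace M"
      using that by auto
    then obtain g where g: "act g p = p" "act g x = y" "act g y = x"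
      using three p unfolding three_transitive_def by blast
    have "?act g (f p) = f (act g p)"
      using f(1) p unfolding G_map_def by simp
    then show ?thesis using g by auto
  qed
  show False
  proof (rule separating_chain_not_swappable[OF G H sep _ p _ _ pab(4)])
    show "a \<in> topspace M - {p}" "b \<in> topspace M - {p}" using T pab by auto
  qed (rule swap)
qed

end
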